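(* Let $G$ be an $(n,d,\lambda)$-graph and $U$ a subset of vertices with $\lambda n/d=o(|U|)$. Then there is a subset $U'\subset U$ with $|U'|=(1-o(1))|U|$ such that \[\left|H_2(U')-(1+o(1))\frac{|U'|^5d^6}{n^6}\right|\ll \lambda^2\frac{|U'|^3d^2}{n^2}.\]
   Context: An $(n,d,\lambda)$-graph is a $d$-regular graph on $n$ vertices all of whose adjacency eigenvalues other than the largest have absolute value at most $\lambda$; $u\sim v$ denotes adjacency. For $W\subset V(G)$, $H_2(W)$ is the number of $5$-tuples $(x,y,z,u,v)\in W^5$ (not necessarily distinct) with $x\sim u$, $u\sim z$, $z\sim y$, $x\sim y$, $u\sim v$, $v\sim y$ (labeled, possibly degenerate copies of $K_{2,3}$). Asymptotic notation refers to $n\to\infty$; $f\ll g$ means $f=O(g)$. *)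

theory Defs
  imports
    "HOL-Library.Landau_Symbols"
    "Graph_Theory.Pair_Digraph"
    "Jordan_Normal_Form.Char_Poly"
begin

text \<open>
  Finite simple graphs are rendered by the locale predicate \<^const>\<open>pair_graph\<close>: finite, loop-free
  and symmetric, so that \<open>u \<sim> v\<close> is \<open>(u, v) \<in> parcs G\<close> and the degree of a vertex is its
  \<^const>\<open>out_degree\<close>.
\<close>

definition adjacency_matrix :: "'a pair_pre_digraph \<Rightarrow> 'a list \<Rightarrow> real mat" where
  "adjacency_matrix G vs =
     mat (length vs) (length vs) (\<lambda>(i, j). if (vs ! i, vs ! j) \<in> parcs G then 1 else 0)"

text \<open>
  Eigenvalues are counted with (algebraic) multiplicity. Changing the enumeration of the vertices
  conjugates the matrix by a permutation matrix, so the choice of enumeration is immaterial; since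
  the matrix is real symmetric, all its eigenvalues are real.
\<close>

definition adjacency_eigenvalues :: "'a pair_pre_digraph \<Rightarrow> real multiset" where
  "adjacency_eigenvalues G =
     proots (char_poly (adjacency_matrix G (SOME vs. distinct vs \<and> set vs = pverts G)))"

text \<open>
  Only one copy of the largest eigenvalue is discarded: if \<open>d\<close> is a multiple eigenvalue, then
  \<open>\<lambda> \<ge> d\<close> is forced.
\<close>

definition ndl_graph :: "'a pair_pre_digraph \<Rightarrow> nat \<Rightarrow> nat \<Rightarrow> real \<Rightarrow> bool" where
  "ndl_graph G n d l \<longleftrightarrow>
     pair_graph G \<and> card (pverts G) = n \<and>
     (\<forall>v \<in> pverts G. out_degree (with_proj G) v = d) \<and>
     (\<forall>\<mu> \<in># adjacency_eigenvalues G - {#Max_mset (adjacency_eigenvalues G)#}. \<bar>\<mu>\<bar> \<le> l)"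

definition H2 :: "'a pair_pre_digraph \<Rightarrow> 'a set \<Rightarrow> nat" where
  "H2 G W = card {(x, y, z, u, v).
     x \<in> W \<and> y \<in> W \<and> z \<in> W \<and> u \<in> W \<and> v \<in> W \<and>
     (x, u) \<in> parcs G \<and> (u, z) \<in> parcs G \<and> (z, y) \<in> parcs G \<and>
     (x, y) \<in> parcs G \<and> (u, v) \<in> parcs G \<and> (v, y) \<in> parcs G}"

end

theory Submission
  imports
    Defs
    "HOL-Analysis.Function_Topology"
    "HOL-Analysis.Convex"
begin

text \<open>
  Write \<open>p = d / n\<close> and let \<open>E\<close> be the adjacency matrix with \<open>p\<close> subtracted from every entry; its
  operator norm is at most \<open>\<lambda>\<close>, and so is that of its restriction to any \<open>W \<subseteq> V(G)\<close>. With \<open>m = |W|\<close>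
  and \<open>e\<^sub>u\<close> the row sums of the restriction, the codegree of \<open>u, y\<close> in \<open>W\<close> is
  \<open>p\<^sup>2m + p(e\<^sub>u + e\<^sub>y) + (E\<^sup>2)\<^sub>u\<^sub>y\<close>, and \<open>H\<^sub>2(W)\<close> is the sum of the cubes of the codegrees. The cube
  of the first term gives the main term. The term linear in \<open>e\<close> is \<open>O(\<lambda> p\<^sup>5 m\<^sup>4)\<close>, a relative error
  \<open>\<lambda> n / (d m) = o(1)\<close>. All the others are \<open>O(\<lambda>\<^sup>2 p\<^sup>2 m\<^sup>3)\<close>: the sums of squares of \<open>p(e\<^sub>u + e\<^sub>y)\<close> and
  of the entries of \<open>E\<^sup>2\<close> are \<open>O(\<lambda>\<^sup>2 p m\<^sup>2)\<close>, and the remaining factor is \<open>O(p m)\<close> pointwise provided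
  that all degrees inside \<open>W\<close> are \<open>O(p m)\<close>. To ensure the latter, discard from \<open>U\<close> the vertices with more
  than \<open>2 p |U|\<close> neighbours in \<open>U\<close>; by the norm bound there are at most \<open>(\<lambda> / p)\<^sup>2 / |U| = o(|U|)\<close>
  of them.
\<close>

section \<open>Spectral bound\<close>

text \<open>Tychonoff's theorem. Vectors indexed by \<open>V\<close> are treated below as total
  functions, so the product runs over the whole index type.\<close>

lemma compact_Pi_UNIV:
  fixes K :: "'a \<Rightarrow> 'b::topological_space set"
  assumes "\<And>i. compact (K i)"
  shows "compact (Pi UNIV K)"
proof -
  have "compactin (product_topology (\<lambda>i. euclidean) UNIV) (PiE UNIV K)"
    using assms by (simp add: compactin_PiE)
  then show ?thesis
    by (simp add: euclidean_product_topology PiE_UNIV_domain)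
qed

text \<open>The part of the spectral theorem needed here: the operator norm is attained at an
  eigenvalue. A unit vector maximising \<open>q (T x) (T x)\<close> is an eigenvector of the square
  of \<open>T\<close>, and factoring \<open>T\<^sup>2 - \<mu>\<^sup>2\<close> then yields one of
  \<open>T\<close> itself.\<close>

lemma symmetric_max_eigenvector:
  fixes M :: "'a \<Rightarrow> 'a \<Rightarrow> real"
  assumes fin: "finite V" and ne: "V \<noteq> {}"
    and sym: "\<And>i j. i \<in> V \<Longrightarrow> j \<in> V \<Longrightarrow> M i j = M j i"
  obtains \<theta> v where
    "\<exists>i\<in>V. v i \<noteq> 0"
    "\<And>i. i \<in> V \<Longrightarrow> (\<Sum>j\<in>V. M i j * v j) = \<theta> * v i"
    "\<And>x. (\<Sum>i\<in>V. (\<Sum>j\<in>V. M i j * x j)\<^sup>2) \<le> \<theta>\<^sup>2 * (\<Sum>i\<in>V. (x i)\<^sup>2)"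
proof -
  define T where "T x i = (\<Sum>j\<in>V. M i j * x j)" for x i
  define q where "q x y = (\<Sum>i\<in>V. x i * y i)" for x y :: "'a \<Rightarrow> real"
  have q_comm: "q x y = q y x" for x y
    by (simp add: q_def mult.commute)
  have q_add: "q (\<lambda>i. x i + t * y i) z = q x z + t * q y z" for x y z t
    by (simp add: q_def algebra_simps sum.distrib sum_distrib_left)
  have T_add: "T (\<lambda>i. x i + t * y i) = (\<lambda>i. T x i + t * T y i)" for x y t
    by (rule ext) (simp add: T_def algebra_simps sum.distrib sum_distrib_left)
  have q_self: "q x x = (\<Sum>i\<in>V. (x i)\<^sup>2)" for x
    by (simp add: q_def power2_eq_square)
  have q_nonneg: "q x x \<ge> 0" for x
    by (simp add: q_self sum_nonneg)
  have q_zero: "q x x = 0 \<longleftrightarrow> (\<forall>i\<in>V. x i = 0)" for x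
    using fin by (simp add: q_self sum_nonneg_eq_0_iff)
  have T_sym: "q (T x) y = q x (T y)" for x y
  proof -
    have "q (T x) y = (\<Sum>i\<in>V. \<Sum>j\<in>V. M i j * x j * y i)"
      by (simp add: q_def T_def sum_distrib_right)
    also have "\<dots> = (\<Sum>j\<in>V. \<Sum>i\<in>V. M i j * x j * y i)"
      by (rule sum.swap)
    also have "\<dots> = (\<Sum>j\<in>V. \<Sum>i\<in>V. M j i * x j * y i)"
      by (intro sum.cong refl) (simp add: sym)
    also have "\<dots> = q x (T y)"
      by (simp add: q_def T_def sum_distrib_left ac_simps)
    finally show ?thesis .
  qed
  \<comment> \<open>The unit sphere as a subset of a compact box. Pinning the coordinates outside
    \<open>V\<close> to 0 makes the box compact, and the normalisation is a closed
    condition.\<close>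
  define K where "K = Pi UNIV (\<lambda>i. if i \<in> V then {-1..1} else {0::real}) \<inter> {x. q x x = 1}"
  have cont_coord: "continuous_on S (\<lambda>x::'a \<Rightarrow> real. x i)" for S i
    by (rule continuous_on_subset[OF continuous_on_product_coordinates]) simp
  have cont_q: "continuous_on UNIV (\<lambda>x. q x x)"
    unfolding q_def by (intro continuous_intros cont_coord)
  have cont_Tq: "continuous_on K (\<lambda>x. q (T x) (T x))"
    unfolding q_def T_def by (intro continuous_intros cont_coord)
  have "closed {x. q x x = 1}"
    by (rule closed_Collect_eq[OF cont_q continuous_on_const])
  then have "compact K"
    unfolding K_def by (intro compact_Int_closed compact_Pi_UNIV) auto
  moreover have "K \<noteq> {}"
  proof -
    obtain a where a: "a \<in> V" using ne by auto
    have "q (\<lambda>i. if i = a then 1 else 0) (\<lambda>i. if i = a then 1 else 0) = 1"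
      using a fin by (simp add: q_def if_distrib cong: if_cong)
    then have "(\<lambda>i. if i = a then 1 else 0) \<in> K"
      using a by (auto simp: K_def)
    then show ?thesis by blast
  qed
  ultimately obtain v where v: "v \<in> K" and
    v_max: "\<And>x. x \<in> K \<Longrightarrow> q (T x) (T x) \<le> q (T v) (T v)"
    using continuous_attains_sup[OF _ _ cont_Tq] by blast
  have v1: "q v v = 1"
    using v by (simp add: K_def)
  define \<mu> where "\<mu> = sqrt (q (T v) (T v))"
  have \<mu>2: "\<mu>\<^sup>2 = q (T v) (T v)"
    by (simp add: \<mu>_def q_nonneg)
  have bound: "q (T x) (T x) \<le> \<mu>\<^sup>2 * q x x" for x
  proof (cases "q x x = 0")
    case True
    then have "T x = (\<lambda>i. 0)"
      by (intro ext) (simp add: T_def q_zero)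
    then show ?thesis using True by (simp add: q_def)
  next
    case False
    define s where "s = sqrt (q x x)"
    have s: "s > 0" "s\<^sup>2 = q x x"
      using False q_nonneg[of x] by (auto simp: s_def)
    define y where "y i = (if i \<in> V then x i / s else 0)" for i
    have Ty: "T y i = T x i / s" for i
      by (simp add: T_def y_def sum_divide_distrib)
    have qy: "q y y = 1"
      using s False by (simp add: q_self y_def power_divide flip: sum_divide_distrib)
    have y_le: "y i \<in> {-1..1}" if "i \<in> V" for i
    proof -
      have "(y i)\<^sup>2 \<le> q y y"
        unfolding q_self using fin that by (intro member_le_sum) auto
      then show ?thesis using qy by (simp add: abs_square_le_1 abs_le_iff)
    qed
    have "y i = 0" if "i \<notin> V" for i
      using that by (simp add: y_def)
    then have "y \<in> K"
      using qy y_le by (simp add: K_def Pi_iff)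
    then have "q (T y) (T y) \<le> \<mu>\<^sup>2"
      using v_max \<mu>2 by simp
    moreover have "q (T y) (T y) = q (T x) (T x) / q x x"
      unfolding s(2)[symmetric]
      by (simp add: q_self Ty power_divide flip: sum_divide_distrib)
    moreover have "q x x > 0"
      using False q_nonneg[of x] by simp
    ultimately show ?thesis
      by (simp add: field_simps)
  qed
  \<comment> \<open>The form \<open>\<mu>\<^sup>2 q - q \<circ> T\<close> is positive semidefinite and vanishes at \<open>v\<close>, so \<open>v\<close> lies in its kernel.\<close>
  define w where "w i = \<mu>\<^sup>2 * v i + (-1) * T (T v) i" for i
  \<comment> \<open>Evaluate the form at \<open>v + t w\<close>: the constant term vanishes, and the
    linear coefficient is \<open>2 * q w w\<close> because \<open>T\<close> is self-adjoint.\<close>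
  have w_pos: "0 \<le> 2 * t * q w w + t\<^sup>2 * (\<mu>\<^sup>2 * q w w - q (T w) (T w))" for t
  proof -
    have "0 \<le> \<mu>\<^sup>2 * q (\<lambda>i. v i + t * w i) (\<lambda>i. v i + t * w i)
        - q (T (\<lambda>i. v i + t * w i)) (T (\<lambda>i. v i + t * w i))"
      using bound by simp
    also have "\<dots> = 2 * t * (\<mu>\<^sup>2 * q v w - q (T v) (T w))
        + t\<^sup>2 * (\<mu>\<^sup>2 * q w w - q (T w) (T w))"
      unfolding T_add q_add q_comm[of _ "\<lambda>i. _ i + t * _ i"]
      using \<mu>2 by (simp add: v1 q_comm[of w v] q_comm[of "T w" "T v"] algebra_simps power2_eq_square)
    also have "\<mu>\<^sup>2 * q v w - q (T v) (T w) = q w w"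
    proof -
      have "q w w = q (\<lambda>i. \<mu>\<^sup>2 * v i + (-1) * T (T v) i) w"
        by (simp add: w_def[abs_def])
      also have "\<dots> = q (\<lambda>i. \<mu>\<^sup>2 * v i) w + (-1) * q (T (T v)) w"
        by (rule q_add)
      also have "q (\<lambda>i. \<mu>\<^sup>2 * v i) w = \<mu>\<^sup>2 * q v w"
        by (simp add: q_def sum_distrib_left ac_simps)
      finally show ?thesis by (simp add: T_sym)
    qed
    finally show ?thesis .
  qed
  have "q w w = 0"
  proof (rule ccontr)
    assume "q w w \<noteq> 0"
    define a where "a = q w w"
    \<comment> \<open>\<open>b\<close> dominates the quadratic coefficient and is positive because
      of the \<open>+ 1\<close>. At \<open>t = - a / b\<close> the linear term wins, leaving at most
      \<open>- a\<^sup>2 / b\<close>.\<close>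
    define b where "b = \<bar>\<mu>\<^sup>2 * q w w - q (T w) (T w)\<bar> + 1"
    have a: "a > 0" and b: "b > 0"
      using \<open>q w w \<noteq> 0\<close> q_nonneg[of w] by (auto simp: a_def b_def)
    have "0 \<le> 2 * (- a / b) * a + (- a / b)\<^sup>2 * b"
      using w_pos[of "- a / b"] unfolding a_def[symmetric]
      by (smt (verit, best) a_def b_def mult_left_mono zero_le_power2)
    also have "\<dots> = - (a\<^sup>2 / b)"
      using b by (simp add: field_simps power2_eq_square)
    finally have "a\<^sup>2 / b \<le> 0" by simp
    moreover have "a\<^sup>2 / b > 0"
      using a b by (intro divide_pos_pos) auto
    ultimately show False by linarith
  qed
  then have TTv: "T (T v) i = \<mu>\<^sup>2 * v i" if "i \<in> V" for i
    using that by (auto simp: q_zero w_def)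
  have v0: "\<exists>i\<in>V. v i \<noteq> 0"
    using v1 q_zero[of v] by auto
  show thesis
  \<comment> \<open>Since \<open>(T - \<mu>) (T + \<mu>) v = 0\<close> on \<open>V\<close>, either
    \<open>(T + \<mu>) v\<close> is an eigenvector for \<open>\<mu>\<close>, or it vanishes and
    \<open>v\<close> is one for \<open>- \<mu>\<close>.\<close>
  proof (cases "\<exists>i\<in>V. T v i + \<mu> * v i \<noteq> 0")
    case True
    have "T (\<lambda>i. T v i + \<mu> * v i) i = \<mu> * (T v i + \<mu> * v i)" if "i \<in> V" for i
      using TTv[OF that] by (simp add: T_add algebra_simps power2_eq_square)
    then show thesis
      using that[of "\<lambda>i. T v i + \<mu> * v i" \<mu>] True bound by (simp add: T_def q_self)
  next
    case False
    then have "T v i = (- \<mu>) * v i" if "i \<in> V" for i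
      using that by (simp add: eq_neg_iff_add_eq_0)
    then show thesis
      using that[of v "- \<mu>"] v0 bound by (simp add: T_def q_self)
  qed
qed

text \<open>
  The all-ones vector is split off by conjugating with the identity matrix whose first column is
  replaced by ones. This discards exactly one copy of \<open>c\<close>, whatever its multiplicity.
\<close>

lemma char_poly_const_row_sum:
  fixes A :: "'a::field mat"
  assumes A: "A \<in> carrier_mat (Suc n) (Suc n)"
    and row: "\<And>i. i < Suc n \<Longrightarrow> (\<Sum>j<Suc n. A $$ (i, j)) = c"
  shows "char_poly A = [:-c, 1:] *
    char_poly (mat n n (\<lambda>(i, j). A $$ (Suc i, Suc j) - A $$ (0, Suc j)))"
proof -
  define N where "N = Suc n"
  define A' where "A' = mat n n (\<lambda>(i, j). A $$ (Suc i, Suc j) - A $$ (0, Suc j))"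
  \<comment> \<open>The matrix of \<open>A\<close> in the basis formed by the all-ones vector and
    the unit vectors other than the first. Its lower right block \<open>A'\<close> is the action on
    the quotient by the all-ones vector.\<close>
  define B where "B = four_block_mat (mat 1 1 (\<lambda>_. c)) (mat 1 n (\<lambda>(i, j). A $$ (0, Suc j))) (0\<^sub>m n 1) A'"
  define P where "P = mat N N (\<lambda>(i, j). if j = 0 \<or> i = j then 1 else (0::'a))"
  define Q where "Q = mat N N (\<lambda>(i, j). if i = j then 1 else if j = 0 then -1 else (0::'a))"
  have carr: "A \<in> carrier_mat N N" "B \<in> carrier_mat N N" "P \<in> carrier_mat N N" "Q \<in> carrier_mat N N"
    using A by (auto simp: N_def B_def P_def Q_def A'_def)
  have P_mult: "(P * X) $$ (i, j) = (if i = 0 then X $$ (0, j) else X $$ (0, j) + X $$ (i, j))"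
    if "X \<in> carrier_mat N N" "i < N" "j < N" for X i j
  proof -
    have "(P * X) $$ (i, j) = (\<Sum>k<N. (if k = 0 \<or> i = k then 1 else 0) * X $$ (k, j))"
      using that by (auto simp: P_def scalar_prod_def lessThan_atLeast0 intro!: sum.cong)
    also have "\<dots> = (\<Sum>k\<in>{0, i}. X $$ (k, j))"
      using that(2) by (intro sum.mono_neutral_cong_right) (auto simp: N_def)
    finally show ?thesis by simp
  qed
  have PQ: "P * Q = 1\<^sub>m N"
  proof (rule eq_matI)
    fix i j assume "i < dim_row (1\<^sub>m N)" "j < dim_col (1\<^sub>m N)"
    then show "(P * Q) $$ (i, j) = 1\<^sub>m N $$ (i, j)"
      using P_mult[OF carr(4), of i j] by (auto simp: Q_def)
  qed (use carr in auto)
  have AP: "A * P = P * B"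
  proof (rule eq_matI)
    fix i j assume "i < dim_row (P * B)" "j < dim_col (P * B)"
    then have ij: "i < N" "j < N" using carr by auto
    have "(A * P) $$ (i, j) = (\<Sum>k<N. A $$ (i, k) * (if j = 0 \<or> k = j then 1 else 0))"
      using ij carr(1) by (auto simp: P_def scalar_prod_def lessThan_atLeast0 intro!: sum.cong)
    also have "\<dots> = (if j = 0 then c else A $$ (i, j))"
      using ij row[of i] by (simp add: N_def if_distrib cong: if_cong)
    also have "\<dots> = (P * B) $$ (i, j)"
      unfolding P_mult[OF carr(2) ij] using ij A
      by (cases i; cases j) (auto simp: B_def A'_def N_def)
    finally show "(A * P) $$ (i, j) = (P * B) $$ (i, j)" .
  qed (use carr in auto)
  have "A = A * (P * Q)"
    using carr by (simp add: PQ)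
  also have "\<dots> = P * B * Q"
    using carr by (simp add: AP flip: assoc_mult_mat)
  finally have "similar_mat_wit A B P Q"
    unfolding similar_mat_wit_def Let_def
    using carr PQ mat_mult_left_right_inverse[OF carr(3,4) PQ] by auto
  then have "char_poly A = char_poly B"
    by (intro char_poly_similar) (auto simp: similar_mat_def)
  also have "\<dots> = char_poly (mat 1 1 (\<lambda>_. c)) * char_poly A'"
    unfolding B_def by (rule char_poly_four_block_zeros_col) (auto simp: A'_def)
  also have "char_poly (mat 1 1 (\<lambda>_. c)) = [:-c, 1:]"
    by (simp add: char_poly_defs det_def sign_def)
  finally show ?thesis by (simp add: A'_def)
qed

text \<open>Compare both sides of the eigenvector equation at a coordinate of maximal modulus. This
  serves to show that \<open>d\<close> is the largest adjacency eigenvalue.\<close>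

lemma eigenvalue_le_row_sum:
  fixes A :: "real mat"
  assumes A: "A \<in> carrier_mat n n"
    and nonneg: "\<And>i j. i < n \<Longrightarrow> j < n \<Longrightarrow> A $$ (i, j) \<ge> 0"
    and row: "\<And>i. i < n \<Longrightarrow> (\<Sum>j<n. A $$ (i, j)) \<le> c"
    and ev: "eigenvalue A \<mu>"
  shows "\<bar>\<mu>\<bar> \<le> c"
proof -
  obtain v where v: "v \<in> carrier_vec n" "v \<noteq> 0\<^sub>v n" "A *\<^sub>v v = \<mu> \<cdot>\<^sub>v v"
    using ev A by (auto simp: eigenvalue_def eigenvector_def)
  have "\<exists>i<n. v $ i \<noteq> 0"
    using v(1,2) by auto
  then obtain i0 where i0: "i0 < n" "v $ i0 \<noteq> 0" by blast
  define m where "m = Max ((\<lambda>i. \<bar>v $ i\<bar>) ` {..<n})"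
  have m: "\<bar>v $ i\<bar> \<le> m" if "i < n" for i
    using that by (auto simp: m_def)
  have "m \<in> (\<lambda>i. \<bar>v $ i\<bar>) ` {..<n}"
    unfolding m_def using i0 by (intro Max_in) auto
  then obtain i where i: "i < n" "m = \<bar>v $ i\<bar>" by auto
  have m_pos: "m > 0"
    using m[OF i0(1)] i0(2) by linarith
  have "\<mu> * v $ i = (A *\<^sub>v v) $ i"
    using v i by simp
  also have "\<dots> = (\<Sum>j<n. A $$ (i, j) * v $ j)"
    using v(1) i A by (auto simp: scalar_prod_def lessThan_atLeast0 intro!: sum.cong)
  finally have "\<bar>\<mu>\<bar> * m = \<bar>\<Sum>j<n. A $$ (i, j) * v $ j\<bar>"
    using i by (simp flip: abs_mult)
  also have "\<dots> \<le> (\<Sum>j<n. A $$ (i, j) * m)"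
    by (intro order.trans[OF sum_abs] sum_mono)
       (use nonneg i m in \<open>auto simp: abs_mult intro!: mult_mono\<close>)
  also have "\<dots> \<le> c * m"
    using row[OF i(1)] m_pos by (simp add: mult_right_mono flip: sum_distrib_right)
  finally show ?thesis using m_pos by simp
qed

section \<open>Operator norm of the centred adjacency matrix\<close>

definition adj :: "'a pair_pre_digraph \<Rightarrow> 'a \<Rightarrow> 'a \<Rightarrow> real" where
  "adj G u v = (if (u, v) \<in> parcs G then 1 else 0)"

lemma ndl_graph_finite: "ndl_graph G n d l \<Longrightarrow> finite (pverts G)"
  by (auto simp: ndl_graph_def pair_graph_def pair_digraph_def pair_fin_digraph_def
      pair_fin_digraph_axioms_def)

lemma adj_sym:
  assumes "ndl_graph G n d l"
  shows "adj G u v = adj G v u"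
proof -
  interpret pair_graph G using assms by (simp add: ndl_graph_def)
  show ?thesis
    using arcs_symmetric by (auto simp: adj_def)
qed

lemma adj_row_sum:
  assumes G: "ndl_graph G n d l" and u: "u \<in> pverts G"
  shows "(\<Sum>v\<in>pverts G. adj G u v) = real d"
proof -
  interpret pair_graph G using G by (simp add: ndl_graph_def)
  have "out_arcs (with_proj G) u = Pair u ` {v \<in> pverts G. (u, v) \<in> parcs G}"
    using in_arcsD2 by (auto simp: out_arcs_def)
  then have "out_degree (with_proj G) u = card {v \<in> pverts G. (u, v) \<in> parcs G}"
    unfolding out_degree_def by (simp add: card_image inj_on_def)
  moreover have "out_degree (with_proj G) u = d"
    using G u by (simp add: ndl_graph_def)
  moreover have "(\<Sum>v\<in>pverts G. adj G u v) = card {v \<in> pverts G. (u, v) \<in> parcs G}"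
    by (simp add: adj_def sum.If_cases pair_finite_verts Int_def)
  ultimately show ?thesis by simp
qed

text \<open>An eigenvector orthogonal to the all-ones vector survives in the quotient by that
  vector. So \<open>\<theta>\<close> is a root of the complementary factor of the characteristic
  polynomial, even if \<open>\<theta> = d\<close>, and is covered by the hypothesis on
  \<open>l\<close>.\<close>

lemma nonprincipal_eigenvalue_le:
  assumes G: "ndl_graph G n d l"
    and v: "\<And>i. i \<in> pverts G \<Longrightarrow> (\<Sum>j\<in>pverts G. adj G i j * v j) = \<theta> * v i"
    and v0: "\<exists>i\<in>pverts G. v i \<noteq> 0" and orth: "(\<Sum>i\<in>pverts G. v i) = 0"
  shows "\<bar>\<theta>\<bar> \<le> l"
proof -
  define V where "V = pverts G"
  \<comment> \<open>The very enumeration chosen in \<open>adjacency_eigenvalues\<close>, so that no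
    invariance under reordering has to be proved.\<close>
  define vs where "vs = (SOME vs. distinct vs \<and> set vs = pverts G)"
  have vs: "distinct vs" "set vs = V"
    using someI_ex[OF finite_distinct_list[OF ndl_graph_finite[OF G]]]
    by (auto simp: vs_def V_def conj_commute)
  define A where "A = adjacency_matrix G vs"
  have "vs \<noteq> []" using v0 vs by (auto simp: V_def)
  then obtain N where N: "length vs = Suc N" by (cases vs) auto
  have A: "A \<in> carrier_mat (Suc N) (Suc N)"
    by (simp add: A_def adjacency_matrix_def N)
  have A_nth: "A $$ (i, j) = adj G (vs ! i) (vs ! j)" if "i < Suc N" "j < Suc N" for i j
    using that by (simp add: A_def adjacency_matrix_def adj_def N)
  have bij: "bij_betw (\<lambda>i. vs ! i) {..<Suc N} V"
    using bij_betw_nth[OF vs(1), of "{..<Suc N}" V] vs N by simp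
  have sum_vs: "(\<Sum>j<Suc N. f (vs ! j)) = (\<Sum>j\<in>V. f j)" for f :: "'a \<Rightarrow> real"
    using sum.reindex_bij_betw[OF bij] .
  have in_V: "vs ! i \<in> V" if "i < Suc N" for i
    using that vs(2) N by (metis nth_mem)
  have row: "(\<Sum>j<Suc N. A $$ (i, j)) = real d" if "i < Suc N" for i
  proof -
    have "(\<Sum>j<Suc N. A $$ (i, j)) = (\<Sum>j<Suc N. adj G (vs ! i) (vs ! j))"
      using that by (intro sum.cong) (auto simp: A_nth)
    also have "\<dots> = real d"
      unfolding sum_vs using adj_row_sum[OF G] in_V[OF that] by (simp add: V_def)
    finally show ?thesis .
  qed
  define A' where "A' = mat N N (\<lambda>(i, j). A $$ (Suc i, Suc j) - A $$ (0, Suc j))"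
  have A': "A' \<in> carrier_mat N N" by (simp add: A'_def)
  have cp: "char_poly A = [:- real d, 1:] * char_poly A'"
    using char_poly_const_row_sum[OF A row] by (simp add: A'_def)
  have cp_nz: "char_poly A \<noteq> 0" "char_poly A' \<noteq> 0"
    using degree_monic_char_poly[OF A] degree_monic_char_poly[OF A'] by auto
  have evs: "adjacency_eigenvalues G = add_mset (real d) (proots (char_poly A'))"
    unfolding adjacency_eigenvalues_def vs_def[symmetric] A_def[symmetric] cp
    by (subst proots_mult) (use cp_nz in auto)
  \<comment> \<open>The copy that \<open>ndl_graph\<close> removes is thereby the factor
    \<open>d\<close> split off in \<open>cp\<close>, and exactly the roots of
    \<open>char_poly A'\<close> remain.\<close>
  have "\<mu> \<le> real d" if "\<mu> \<in># adjacency_eigenvalues G" for \<mu>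
  proof -
    have "poly (char_poly A) \<mu> = 0"
      using that cp_nz unfolding adjacency_eigenvalues_def vs_def[symmetric] A_def[symmetric]
      by simp
    then have "eigenvalue A \<mu>"
      using eigenvalue_root_char_poly[OF A] by simp
    then have "\<bar>\<mu>\<bar> \<le> real d"
      by (rule eigenvalue_le_row_sum[OF A, rotated 2]) (simp_all only: row A_nth, simp_all add: adj_def)
    then show ?thesis by simp
  qed
  then have "Max_mset (adjacency_eigenvalues G) = real d"
    by (intro Max_eqI) (auto simp: evs)
  then have bound: "\<bar>\<mu>\<bar> \<le> l" if "\<mu> \<in># proots (char_poly A')" for \<mu>
    using G that by (auto simp: ndl_graph_def evs)
  \<comment> \<open>The coordinates of \<open>v\<close> modulo the all-ones vector. They all vanish
    only for constant \<open>v\<close>, which \<open>orth\<close> would force to be 0.\<close>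
  define w where "w = vec N (\<lambda>i. v (vs ! Suc i) - v (vs ! 0))"
  have "w \<noteq> 0\<^sub>v N"
  proof
    assume "w = 0\<^sub>v N"
    then have w0: "w $ i = 0" if "i < N" for i using that by simp
    have const: "v (vs ! i) = v (vs ! 0)" if "i < Suc N" for i
      using w0[of "i - 1"] that by (cases i) (auto simp: w_def)
    have "0 = (\<Sum>i<Suc N. v (vs ! i))"
      unfolding sum_vs using orth by (simp add: V_def)
    also have "\<dots> = (\<Sum>i<Suc N. v (vs ! 0))"
      by (rule sum.cong[OF refl], rule const) simp
    finally have "v (vs ! 0) = 0" by (simp del: sum.lessThan_Suc)
    then have "v i = 0" if "i \<in> V" for i
      using that const vs(2) N by (metis in_set_conv_nth)
    then show False using v0 by (auto simp: V_def)
  qed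
  moreover have "A' *\<^sub>v w = \<theta> \<cdot>\<^sub>v w"
  proof (rule eq_vecI)
    fix i assume "i < dim_vec (\<theta> \<cdot>\<^sub>v w)"
    then have i: "i < N" by (simp add: w_def)
    define a where "a = vs ! 0"
    define b where "b = vs ! Suc i"
    have ab: "a \<in> V" "b \<in> V" using in_V i by (auto simp: a_def b_def)
    have "(A' *\<^sub>v w) $ i = (\<Sum>j<N. (adj G b (vs ! Suc j) - adj G a (vs ! Suc j)) * (v (vs ! Suc j) - v a))"
      using i by (auto simp: A'_def w_def scalar_prod_def lessThan_atLeast0 A_nth a_def b_def intro!: sum.cong)
    \<comment> \<open>The added summand, at \<open>vs ! 0\<close>, is 0 because its last factor
      vanishes.\<close>
    also have "\<dots> = (\<Sum>j<Suc N. (adj G b (vs ! j) - adj G a (vs ! j)) * (v (vs ! j) - v a))"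
      by (subst sum.lessThan_Suc_shift) (simp add: a_def)
    also have "\<dots> = (\<Sum>j\<in>V. (adj G b j - adj G a j) * (v j - v a))"
      by (rule sum_vs)
    also have "\<dots> = (\<Sum>j\<in>V. adj G b j * v j) - (\<Sum>j\<in>V. adj G a j * v j)
        - ((\<Sum>j\<in>V. adj G b j) - (\<Sum>j\<in>V. adj G a j)) * v a"
      by (simp add: algebra_simps sum.distrib sum_subtractf sum_distrib_left)
    also have "\<dots> = \<theta> * (v b - v a)"
      using v adj_row_sum[OF G] ab by (simp add: V_def algebra_simps)
    finally show "(A' *\<^sub>v w) $ i = (\<theta> \<cdot>\<^sub>v w) $ i"
      using i by (simp add: w_def a_def b_def)
  qed (simp add: A'_def w_def)
  ultimately have "eigenvalue A' \<theta>"
    unfolding eigenvalue_def eigenvector_def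
    by (intro exI[of _ w]) (simp add: A'_def w_def)
  then have "\<theta> \<in># proots (char_poly A')"
    using eigenvalue_root_char_poly[OF A'] cp_nz by simp
  then show ?thesis by (rule bound)
qed

text \<open>The rows of \<open>M\<close> sum to 0, so an eigenvector of \<open>M\<close> with
  \<open>\<theta> \<noteq> 0\<close> is orthogonal to the all-ones vector and is also an eigenvector
  of the adjacency matrix. For \<open>\<theta> = 0\<close> the bound is trivial.\<close>

lemma ndl_graph_operator_bound:
  assumes G: "ndl_graph G n d l"
  shows "(\<Sum>i\<in>pverts G. (\<Sum>j\<in>pverts G. (adj G i j - real d / real n) * x j)\<^sup>2)
    \<le> l\<^sup>2 * (\<Sum>i\<in>pverts G. (x i)\<^sup>2)"
proof (cases "pverts G = {}")
  case False
  define V where "V = pverts G"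
  have fin: "finite V" using ndl_graph_finite[OF G] by (simp add: V_def)
  have n: "card V = n" "n > 0"
    using G False fin by (auto simp: ndl_graph_def V_def)
  define M where "M i j = adj G i j - real d / real n" for i j
  have M_row: "(\<Sum>j\<in>V. M i j) = 0" if "i \<in> V" for i
    using adj_row_sum[OF G] that n by (simp add: M_def sum_subtractf V_def)
  have M_sym: "M i j = M j i" for i j
    using adj_sym[OF G, of i j] by (simp add: M_def)
  obtain \<theta> v where v0: "\<exists>i\<in>V. v i \<noteq> 0"
    and v: "\<And>i. i \<in> V \<Longrightarrow> (\<Sum>j\<in>V. M i j * v j) = \<theta> * v i"
    and bound: "\<And>x. (\<Sum>i\<in>V. (\<Sum>j\<in>V. M i j * x j)\<^sup>2) \<le> \<theta>\<^sup>2 * (\<Sum>i\<in>V. (x i)\<^sup>2)"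
  proof (rule symmetric_max_eigenvector[of V M])
    show "finite V" by (rule fin)
    show "V \<noteq> {}" using False by (simp add: V_def)
  qed (rule M_sym, blast)
  have "\<theta>\<^sup>2 \<le> l\<^sup>2"
  proof (cases "\<theta> = 0")
    case False
    have "\<theta> * (\<Sum>i\<in>V. v i) = (\<Sum>i\<in>V. \<Sum>j\<in>V. M i j * v j)"
      by (simp add: v sum_distrib_left)
    also have "\<dots> = (\<Sum>j\<in>V. \<Sum>i\<in>V. M j i * v j)"
      by (subst sum.swap) (simp add: M_sym)
    also have "\<dots> = 0"
      by (simp add: M_row flip: sum_distrib_right)
    finally have orth: "(\<Sum>i\<in>V. v i) = 0" using False by simp
    have "(\<Sum>j\<in>V. adj G i j * v j) = \<theta> * v i" if "i \<in> V" for i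
    proof -
      have "(\<Sum>j\<in>V. adj G i j * v j) = (\<Sum>j\<in>V. M i j * v j) + real d / real n * (\<Sum>j\<in>V. v j)"
        by (simp add: M_def algebra_simps sum_subtractf sum_distrib_left sum_divide_distrib)
      then show ?thesis using v[OF that] orth by simp
    qed
    then have "\<bar>\<theta>\<bar> \<le> l"
      using nonprincipal_eigenvalue_le[OF G] v0 orth unfolding V_def by blast
    then show ?thesis by (simp add: abs_le_square_iff[symmetric])
  qed simp
  then show ?thesis
    using bound[of x] mult_right_mono[OF \<open>\<theta>\<^sup>2 \<le> l\<^sup>2\<close>, of "\<Sum>i\<in>V. (x i)\<^sup>2"]
    by (simp add: sum_nonneg V_def M_def)
qed simp

text \<open>Extend \<open>x\<close> by 0 to all vertices and drop the rows outside
  \<open>W\<close>.\<close>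

lemma ndl_graph_operator_bound_subset:
  assumes G: "ndl_graph G n d l" and W: "W \<subseteq> pverts G"
  shows "(\<Sum>i\<in>W. (\<Sum>j\<in>W. (adj G i j - real d / real n) * x j)\<^sup>2) \<le> l\<^sup>2 * (\<Sum>i\<in>W. (x i)\<^sup>2)"
proof -
  define M where "M i j = adj G i j - real d / real n" for i j
  define y where "y i = (if i \<in> W then x i else 0)" for i
  note fin = ndl_graph_finite[OF G]
  have restrict: "(\<Sum>j\<in>pverts G. f j * y j) = (\<Sum>j\<in>W. f j * x j)" for f
    using fin W by (intro sum.mono_neutral_cong_right) (auto simp: y_def)
  have "(\<Sum>i\<in>W. (\<Sum>j\<in>W. M i j * x j)\<^sup>2) \<le> (\<Sum>i\<in>pverts G. (\<Sum>j\<in>W. M i j * x j)\<^sup>2)"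
    using fin W by (intro sum_mono2) auto
  also have "\<dots> = (\<Sum>i\<in>pverts G. (\<Sum>j\<in>pverts G. M i j * y j)\<^sup>2)"
    by (simp add: restrict)
  also have "\<dots> \<le> l\<^sup>2 * (\<Sum>i\<in>pverts G. (y i)\<^sup>2)"
    unfolding M_def by (rule ndl_graph_operator_bound[OF G])
  also have "(\<Sum>i\<in>pverts G. (y i)\<^sup>2) = (\<Sum>i\<in>W. (x i)\<^sup>2)"
    using fin W by (intro sum.mono_neutral_cong_right) (auto simp: y_def)
  finally show ?thesis by (simp add: M_def)
qed

section \<open>Counting\<close>

text \<open>The cube of \<open>a + (b + f)\<close> is split as
  \<open>a^3 + 3 a^2 b + 3 a^2 f + r\<close>. The term in \<open>b\<close> gives the second error,
  while \<open>f\<close> and \<open>r\<close> contribute 3 and 288 to the constant 291. The 4 in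
  \<open>deg\<close> is the 2 from \<open>typical_part\<close> times a 2 for passing from
  \<open>U\<close> to a subset of at least half its size.\<close>

lemma cubed_codegree_sum:
  fixes B :: "'a \<Rightarrow> 'a \<Rightarrow> real" and p L :: real
  assumes p: "0 \<le> p" "p \<le> 1" and L: "0 \<le> L"
    and B01: "\<And>i j. i \<in> W \<Longrightarrow> j \<in> W \<Longrightarrow> B i j = 0 \<or> B i j = 1"
    and sym: "\<And>i j. i \<in> W \<Longrightarrow> j \<in> W \<Longrightarrow> B i j = B j i"
    and op: "\<And>x. (\<Sum>i\<in>W. (\<Sum>j\<in>W. (B i j - p) * x j)\<^sup>2) \<le> L\<^sup>2 * (\<Sum>i\<in>W. (x i)\<^sup>2)"
    and deg: "\<And>i. i \<in> W \<Longrightarrow> (\<Sum>j\<in>W. B i j) \<le> 4 * p * card W"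
  shows "\<bar>(\<Sum>u\<in>W. \<Sum>y\<in>W. (\<Sum>w\<in>W. B u w * B w y) ^ 3) - p ^ 6 * card W ^ 5\<bar>
    \<le> 291 * (L\<^sup>2 * p\<^sup>2 * card W ^ 3) + 6 * L * p ^ 5 * card W ^ 4"
proof -
  define m where "m = real (card W)"
  have m0: "m \<ge> 0" by (simp add: m_def)
  define E where "E i j = B i j - p" for i j
  define e where "e u = (\<Sum>j\<in>W. E u j)" for u
  define f where "f u y = (\<Sum>w\<in>W. E u w * E w y)" for u y
  define a where "a = p\<^sup>2 * m"
  define b where "b u y = p * (e u + e y)" for u y
  have E_sym: "E i j = E j i" if "i \<in> W" "j \<in> W" for i j
    using sym[OF that] by (simp add: E_def)
  have opE: "(\<Sum>i\<in>W. (\<Sum>j\<in>W. E i j * x j)\<^sup>2) \<le> L\<^sup>2 * (\<Sum>i\<in>W. (x i)\<^sup>2)" for x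
    using op by (simp add: E_def)
  have a0: "0 \<le> a" using m0 by (simp add: a_def)
  have pm: "0 \<le> p * m" using p m0 by simp
  have codeg: "(\<Sum>w\<in>W. B u w * B w y) = a + (b u y + f u y)" if "u \<in> W" "y \<in> W" for u y
  proof -
    have "(\<Sum>w\<in>W. B u w * B w y) = (\<Sum>w\<in>W. p\<^sup>2 + p * E u w + p * E y w + E u w * E w y)"
      using that by (intro sum.cong refl) (simp add: E_def sym[of y] algebra_simps power2_eq_square)
    then show ?thesis
      by (simp add: sum.distrib a_def b_def f_def e_def m_def sum_distrib_left algebra_simps)
  qed
  have e_sq: "(\<Sum>u\<in>W. (e u)\<^sup>2) \<le> L\<^sup>2 * m"
    using opE[of "\<lambda>_. 1"] by (simp add: e_def m_def)
  have e_sum: "\<bar>\<Sum>u\<in>W. e u\<bar> \<le> L * m"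
  proof -
    have "(\<Sum>u\<in>W. e u)\<^sup>2 \<le> m * (\<Sum>u\<in>W. (e u)\<^sup>2)"
      using Cauchy_Schwarz_ineq_sum[of "\<lambda>_. 1" e W] by (simp add: m_def)
    also have "\<dots> \<le> m * (L\<^sup>2 * m)"
      by (rule mult_left_mono[OF e_sq m0])
    also have "\<dots> = (L * m)\<^sup>2" by (simp add: power2_eq_square)
    finally show ?thesis using L m0 by (simp add: abs_le_square_iff[symmetric])
  qed
  \<comment> \<open>By symmetry the entries of \<open>E\<^sup>2\<close> add up to the squared norm
    of \<open>E\<close> applied to the all-ones vector, so the term linear in \<open>f\<close> is
    already quadratic in \<open>L\<close>.\<close>
  have f_sum: "(\<Sum>u\<in>W. \<Sum>y\<in>W. f u y) = (\<Sum>w\<in>W. (e w)\<^sup>2)"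
  proof -
    have "(\<Sum>u\<in>W. \<Sum>y\<in>W. f u y) = (\<Sum>u\<in>W. \<Sum>w\<in>W. E u w * e w)"
      unfolding f_def e_def sum_distrib_left by (intro sum.cong refl sum.swap)
    also have "\<dots> = (\<Sum>w\<in>W. \<Sum>u\<in>W. E u w * e w)" by (rule sum.swap)
    also have "\<dots> = (\<Sum>w\<in>W. (e w)\<^sup>2)"
      unfolding power2_eq_square e_def sum_distrib_right
      by (intro sum.cong refl) (simp add: E_sym)
    finally show ?thesis .
  qed
  have B_sum: "0 \<le> (\<Sum>j\<in>W. B u j)" if "u \<in> W" for u
    using B01[OF that] by (intro sum_nonneg) force
  have e_bound: "\<bar>e u\<bar> \<le> 4 * (p * m)" if "u \<in> W" for u
  proof -
    have "e u = (\<Sum>j\<in>W. B u j) - p * m"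
      by (simp add: e_def E_def sum_subtractf m_def)
    then show ?thesis
      using B_sum[OF that] deg[OF that] pm by (simp add: m_def abs_le_iff)
  qed
  \<comment> \<open>An entry of \<open>E\<close> is \<open>- p\<close> or \<open>1 - p\<close>, so
    its square is at most \<open>B u w + p\<close>; a row then contributes \<open>4 + 1\<close>
    times \<open>p * m\<close>.\<close>
  have E_sq: "(\<Sum>w\<in>W. (E u w)\<^sup>2) \<le> 5 * (p * m)" if "u \<in> W" for u
  proof -
    have "(E u w)\<^sup>2 \<le> B u w + p" if "w \<in> W" for w
    proof -
      have "p\<^sup>2 \<le> p" "(1 - p)\<^sup>2 \<le> 1"
        using p by (auto simp: power2_eq_square mult_left_le_one_le mult_le_one)
      then show ?thesis
        using B01[OF \<open>u \<in> W\<close> that] p by (auto simp: E_def)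
    qed
    then have "(\<Sum>w\<in>W. (E u w)\<^sup>2) \<le> (\<Sum>w\<in>W. B u w + p)"
      by (rule sum_mono)
    also have "\<dots> \<le> 5 * (p * m)"
      using deg[OF that] by (simp add: sum.distrib m_def algebra_simps)
    finally show ?thesis .
  qed
  have f_bound: "\<bar>f u y\<bar> \<le> 5 * (p * m)" if "u \<in> W" "y \<in> W" for u y
  proof -
    have "\<bar>f u y\<bar> \<le> (\<Sum>w\<in>W. \<bar>E u w * E w y\<bar>)"
      unfolding f_def by (rule sum_abs)
    also have "\<dots> \<le> (\<Sum>w\<in>W. ((E u w)\<^sup>2 + (E y w)\<^sup>2) / 2)"
    proof (rule sum_mono)
      fix w assume "w \<in> W"
      have "0 \<le> (\<bar>E u w\<bar> - \<bar>E y w\<bar>)\<^sup>2" by simp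
      then show "\<bar>E u w * E w y\<bar> \<le> ((E u w)\<^sup>2 + (E y w)\<^sup>2) / 2"
        using E_sym[OF \<open>w \<in> W\<close> \<open>y \<in> W\<close>] by (simp add: power2_diff abs_mult)
    qed
    also have "\<dots> \<le> 5 * (p * m)"
      using E_sq[OF that(1)] E_sq[OF that(2)]
      by (simp add: sum.distrib flip: sum_divide_distrib)
    finally show ?thesis .
  qed
  \<comment> \<open>The norm bound is applied to each column of \<open>E\<close> separately, and
    \<open>E_sq\<close> bounds the columns.\<close>
  have f_sq: "(\<Sum>u\<in>W. \<Sum>y\<in>W. (f u y)\<^sup>2) \<le> 5 * (L\<^sup>2 * p * m\<^sup>2)"
  proof -
    have "(\<Sum>u\<in>W. \<Sum>y\<in>W. (f u y)\<^sup>2) = (\<Sum>y\<in>W. \<Sum>u\<in>W. (\<Sum>w\<in>W. E u w * E w y)\<^sup>2)"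
      unfolding f_def by (rule sum.swap)
    also have "\<dots> \<le> (\<Sum>y\<in>W. L\<^sup>2 * (\<Sum>w\<in>W. (E w y)\<^sup>2))"
      by (intro sum_mono opE)
    also have "\<dots> \<le> (\<Sum>y\<in>W. L\<^sup>2 * (5 * (p * m)))"
    proof (intro sum_mono mult_left_mono)
      fix y assume "y \<in> W"
      then show "(\<Sum>w\<in>W. (E w y)\<^sup>2) \<le> 5 * (p * m)"
        using E_sq[OF \<open>y \<in> W\<close>] by (simp add: E_sym)
    qed simp
    also have "\<dots> = 5 * (L\<^sup>2 * p * m\<^sup>2)"
      by (simp add: m_def power2_eq_square)
    finally show ?thesis .
  qed
  \<comment> \<open>A factor \<open>p \<le> 1\<close> is given away at the end to match the shape of
    \<open>f_sq\<close>.\<close>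
  have b_sq: "(\<Sum>u\<in>W. \<Sum>y\<in>W. (b u y)\<^sup>2) \<le> 4 * (L\<^sup>2 * p * m\<^sup>2)"
  proof -
    have "(\<Sum>u\<in>W. \<Sum>y\<in>W. (b u y)\<^sup>2) \<le> (\<Sum>u\<in>W. \<Sum>y\<in>W. p\<^sup>2 * (2 * (e u)\<^sup>2 + 2 * (e y)\<^sup>2))"
    proof (intro sum_mono)
      fix u y
      have "0 \<le> (e u - e y)\<^sup>2" by simp
      then have "(e u + e y)\<^sup>2 \<le> 2 * (e u)\<^sup>2 + 2 * (e y)\<^sup>2"
        by (simp add: power2_sum power2_diff)
      then show "(b u y)\<^sup>2 \<le> p\<^sup>2 * (2 * (e u)\<^sup>2 + 2 * (e y)\<^sup>2)"
        by (simp add: b_def power_mult_distrib mult_left_mono)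
    qed
    also have "\<dots> = 4 * p\<^sup>2 * m * (\<Sum>u\<in>W. (e u)\<^sup>2)"
      by (simp add: sum.distrib m_def algebra_simps flip: sum_distrib_left)
    also have "\<dots> \<le> 4 * p\<^sup>2 * m * (L\<^sup>2 * m)"
      using m0 by (intro mult_left_mono e_sq) auto
    also have "\<dots> = p * (4 * (L\<^sup>2 * p * m\<^sup>2))"
      by (simp add: power2_eq_square)
    also have "\<dots> \<le> 4 * (L\<^sup>2 * p * m\<^sup>2)"
      using p by (intro mult_left_le_one_le) auto
    finally show ?thesis .
  qed
  \<comment> \<open>All terms of the cube that are at least quadratic in
    \<open>b + f\<close>.\<close>
  define r where "r u y = (3 * a + (b u y + f u y)) * (b u y + f u y)\<^sup>2" for u y
  have r_bound: "\<bar>\<Sum>u\<in>W. \<Sum>y\<in>W. r u y\<bar> \<le> 288 * (L\<^sup>2 * p\<^sup>2 * m ^ 3)"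
  proof -
    have pointwise: "\<bar>r u y\<bar> \<le> 16 * (p * m) * (2 * (b u y)\<^sup>2 + 2 * (f u y)\<^sup>2)"
      if "u \<in> W" "y \<in> W" for u y
    proof -
      have "p * (p * m) \<le> p * m"
        using p pm by (intro mult_left_le_one_le) auto
      then have a_le: "a \<le> p * m" by (simp add: a_def power2_eq_square ac_simps)
      have "\<bar>b u y\<bar> \<le> p * (8 * (p * m))"
        unfolding b_def abs_mult using p e_bound[OF that(1)] e_bound[OF that(2)]
        by (intro mult_mono) auto
      also have "\<dots> \<le> 8 * (p * m)"
        using p pm by (intro mult_left_le_one_le) auto
      finally have b_le: "\<bar>b u y\<bar> \<le> 8 * (p * m)" .
      \<comment> \<open>Here \<open>16 = 3 + 8 + 5\<close>, from \<open>3 * a\<close>,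
        \<open>b\<close> and \<open>f\<close>; the final constant is
        \<open>288 = 16 * 2 * (4 + 5)\<close>.\<close>
      have "\<bar>3 * a + (b u y + f u y)\<bar> \<le> 16 * (p * m)"
        using a_le a0 b_le f_bound[OF that] by linarith
      moreover have "(b u y + f u y)\<^sup>2 \<le> 2 * (b u y)\<^sup>2 + 2 * (f u y)\<^sup>2"
        using zero_le_power2[of "b u y - f u y"] by (simp add: power2_sum power2_diff)
      ultimately show ?thesis
        unfolding r_def abs_mult using pm by (intro mult_mono) auto
    qed
    have "\<bar>\<Sum>u\<in>W. \<Sum>y\<in>W. r u y\<bar> \<le> (\<Sum>u\<in>W. \<Sum>y\<in>W. \<bar>r u y\<bar>)"
      by (intro order.trans[OF sum_abs] sum_mono sum_abs)
    also have "\<dots> \<le> (\<Sum>u\<in>W. \<Sum>y\<in>W. 16 * (p * m) * (2 * (b u y)\<^sup>2 + 2 * (f u y)\<^sup>2))"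
      by (intro sum_mono pointwise)
    also have "\<dots> = 32 * (p * m) * ((\<Sum>u\<in>W. \<Sum>y\<in>W. (b u y)\<^sup>2) + (\<Sum>u\<in>W. \<Sum>y\<in>W. (f u y)\<^sup>2))"
      by (simp add: sum.distrib algebra_simps flip: sum_distrib_left)
    also have "\<dots> \<le> 32 * (p * m) * (4 * (L\<^sup>2 * p * m\<^sup>2) + 5 * (L\<^sup>2 * p * m\<^sup>2))"
      using pm by (intro mult_left_mono add_mono b_sq f_sq) auto
    also have "\<dots> = 288 * (L\<^sup>2 * p\<^sup>2 * m ^ 3)"
      by (simp add: power2_eq_square power3_eq_cube)
    finally show ?thesis .
  qed
  have "(\<Sum>u\<in>W. \<Sum>y\<in>W. (\<Sum>w\<in>W. B u w * B w y) ^ 3)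
      = (\<Sum>u\<in>W. \<Sum>y\<in>W. a ^ 3 + 3 * a\<^sup>2 * b u y + 3 * a\<^sup>2 * f u y + r u y)"
    by (intro sum.cong refl)
       (simp add: codeg r_def power2_eq_square power3_eq_cube algebra_simps)
  also have "\<dots> = m\<^sup>2 * a ^ 3 + 3 * a\<^sup>2 * (\<Sum>u\<in>W. \<Sum>y\<in>W. b u y)
      + 3 * a\<^sup>2 * (\<Sum>u\<in>W. \<Sum>y\<in>W. f u y) + (\<Sum>u\<in>W. \<Sum>y\<in>W. r u y)"
    by (simp add: sum.distrib sum_distrib_left m_def power2_eq_square)
  also have "m\<^sup>2 * a ^ 3 = p ^ 6 * m ^ 5"
    by (simp add: a_def power_mult_distrib flip: power_mult power_add)
  also have "(\<Sum>u\<in>W. \<Sum>y\<in>W. b u y) = 2 * p * m * (\<Sum>u\<in>W. e u)"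
    by (simp add: b_def sum.distrib m_def algebra_simps flip: sum_distrib_left sum_distrib_right)
  finally have "(\<Sum>u\<in>W. \<Sum>y\<in>W. (\<Sum>w\<in>W. B u w * B w y) ^ 3) - p ^ 6 * m ^ 5
      = 3 * a\<^sup>2 * (2 * p * m * (\<Sum>u\<in>W. e u)) + 3 * a\<^sup>2 * (\<Sum>u\<in>W. (e u)\<^sup>2)
        + (\<Sum>u\<in>W. \<Sum>y\<in>W. r u y)"
    by (simp add: f_sum)
  moreover have "\<bar>3 * a\<^sup>2 * (2 * p * m * (\<Sum>u\<in>W. e u))\<bar> \<le> 6 * L * p ^ 5 * m ^ 4"
  proof -
    have "\<bar>3 * a\<^sup>2 * (2 * p * m * (\<Sum>u\<in>W. e u))\<bar> = 6 * a\<^sup>2 * (p * m) * \<bar>\<Sum>u\<in>W. e u\<bar>"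
      using p m0 by (simp add: abs_mult)
    also have "\<dots> \<le> 6 * a\<^sup>2 * (p * m) * (L * m)"
      using pm by (intro mult_left_mono e_sum) auto
    also have "\<dots> = 6 * L * p ^ 5 * m ^ 4"
      by (simp add: a_def eval_nat_numeral)
    finally show ?thesis .
  qed
  \<comment> \<open>The natural bound carries \<open>p^4\<close>; two of these powers are given
    away.\<close>
  moreover have "\<bar>3 * a\<^sup>2 * (\<Sum>u\<in>W. (e u)\<^sup>2)\<bar> \<le> 3 * (L\<^sup>2 * p\<^sup>2 * m ^ 3)"
  proof -
    have "\<bar>3 * a\<^sup>2 * (\<Sum>u\<in>W. (e u)\<^sup>2)\<bar> = 3 * a\<^sup>2 * (\<Sum>u\<in>W. (e u)\<^sup>2)"
      by (simp add: sum_nonneg)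
    also have "\<dots> \<le> 3 * a\<^sup>2 * (L\<^sup>2 * m)"
      by (intro mult_left_mono e_sq) auto
    also have "\<dots> = p\<^sup>2 * (3 * (L\<^sup>2 * p\<^sup>2 * m ^ 3))"
      by (simp add: a_def eval_nat_numeral)
    also have "\<dots> \<le> 3 * (L\<^sup>2 * p\<^sup>2 * m ^ 3)"
      using p m0 by (intro mult_left_le_one_le) (auto simp: power_le_one)
    finally show ?thesis .
  qed
  ultimately show ?thesis
    using r_bound by (simp add: m_def)
qed

text \<open>For fixed \<open>u\<close> and \<open>y\<close>, the vertices \<open>x\<close>,
  \<open>z\<close>, \<open>v\<close> range independently over the common neighbours of
  \<open>u\<close> and \<open>y\<close> in \<open>W\<close>. Degenerate copies are counted, so the
  cube is exact.\<close>

lemma H2_eq_sum_codegree_cubed: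
  assumes G: "ndl_graph G n d l" and W: "W \<subseteq> pverts G"
  shows "real (H2 G W) = (\<Sum>u\<in>W. \<Sum>y\<in>W. (\<Sum>w\<in>W. adj G u w * adj G w y) ^ 3)"
proof -
  interpret pair_graph G using G by (simp add: ndl_graph_def)
  have fin: "finite W" using W pair_finite_verts finite_subset by blast
  define N where "N u y = {w \<in> W. (u, w) \<in> parcs G \<and> (w, y) \<in> parcs G}" for u y
  have fin_N: "finite (N u y)" for u y
    using fin by (simp add: N_def)
  define S where "S = (SIGMA (u, y):W \<times> W. N u y \<times> N u y \<times> N u y)"
  have "{(x, y, z, u, v).
     x \<in> W \<and> y \<in> W \<and> z \<in> W \<and> u \<in> W \<and> v \<in> W \<and>
     (x, u) \<in> parcs G \<and> (u, z) \<in> parcs G \<and> (z, y) \<in> parcs G \<and>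
     (x, y) \<in> parcs G \<and> (u, v) \<in> parcs G \<and> (v, y) \<in> parcs G}
     = (\<lambda>((u, y), (x, z, v)). (x, y, z, u, v)) ` S"
    (is "?T = ?f ` S")
  proof (intro equalityI subsetI)
    fix t assume "t \<in> ?T"
    then show "t \<in> ?f ` S"
      using arcs_symmetric by (force simp: S_def N_def image_iff)
  next
    fix t assume "t \<in> ?f ` S"
    then show "t \<in> ?T"
      using arcs_symmetric by (auto simp: S_def N_def)
  qed
  moreover have "inj_on ?f S"
    by (auto simp: inj_on_def)
  ultimately have "H2 G W = card S"
    unfolding H2_def by (simp add: card_image)
  also have "\<dots> = (\<Sum>(u, y)\<in>W \<times> W. card (N u y) ^ 3)"
    unfolding S_def using fin fin_N
    by (subst card_SigmaI) (auto simp: card_cartesian_product power3_eq_cube ac_simps intro!: sum.cong)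
  also have "\<dots> = (\<Sum>u\<in>W. \<Sum>y\<in>W. card (N u y) ^ 3)"
    by (rule sum.cartesian_product[symmetric])
  finally have "real (H2 G W) = (\<Sum>u\<in>W. \<Sum>y\<in>W. real (card (N u y)) ^ 3)"
    by simp
  moreover have "real (card (N u y)) = (\<Sum>w\<in>W. adj G u w * adj G w y)" for u y
  proof -
    have "(\<Sum>w\<in>W. adj G u w * adj G w y) = (\<Sum>w\<in>W. if w \<in> N u y then 1 else 0)"
      by (intro sum.cong) (auto simp: adj_def N_def)
    also have "\<dots> = real (card (W \<inter> N u y))"
      using fin by (simp add: sum.If_cases)
    also have "W \<inter> N u y = N u y" by (auto simp: N_def)
    finally show ?thesis by simp
  qed
  ultimately show ?thesis by simp
qed

section \<open>Discarding the vertices of large degree\<close>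

text \<open>The inequality is not strict, so nothing is discarded when \<open>d = 0\<close>.\<close>

definition typical_part :: "'a pair_pre_digraph \<Rightarrow> real \<Rightarrow> 'a set \<Rightarrow> 'a set" where
  "typical_part G p U = {u \<in> U. (\<Sum>v\<in>U. adj G u v) \<le> 2 * p * card U}"

text \<open>Chebyshev's inequality: a discarded vertex has centred row sum at least
  \<open>p * card U\<close>, and the squares of these sums are controlled by the norm bound on the
  all-ones vector.\<close>

lemma card_atypical_part:
  fixes n d :: nat and l :: real
  assumes G: "ndl_graph G n d l" and U: "U \<subseteq> pverts G"
  shows "real (card (U - typical_part G (d / n) U)) * (d / n * card U)\<^sup>2 \<le> l\<^sup>2 * card U"
proof -
  have fin: "finite U" using U ndl_graph_finite[OF G] finite_subset by blast
  define p where "p = real d / real n"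
  define R where "R = U - typical_part G p U"
  have p: "p \<ge> 0" by (simp add: p_def)
  have "real (card R) * (p * card U)\<^sup>2 = (\<Sum>u\<in>R. (p * card U)\<^sup>2)" by simp
  also have "\<dots> \<le> (\<Sum>u\<in>R. (\<Sum>v\<in>U. adj G u v - p)\<^sup>2)"
  proof (rule sum_mono)
    fix u assume "u \<in> R"
    then have "p * card U \<le> (\<Sum>v\<in>U. adj G u v - p)"
      by (auto simp: R_def typical_part_def sum_subtractf not_le)
    then show "(p * card U)\<^sup>2 \<le> (\<Sum>v\<in>U. adj G u v - p)\<^sup>2"
      using p by (intro power_mono) auto
  qed
  also have "\<dots> \<le> (\<Sum>u\<in>U. (\<Sum>v\<in>U. adj G u v - p)\<^sup>2)"
    using fin by (intro sum_mono2) (auto simp: R_def)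
  also have "\<dots> \<le> l\<^sup>2 * card U"
    using ndl_graph_operator_bound_subset[OF G U, of "\<lambda>_. 1"] by (simp add: p_def)
  finally show ?thesis by (simp add: R_def p_def)
qed

lemma ndl_graph_degree_le:
  assumes G: "ndl_graph G n d l"
  shows "real d / real n \<le> 1"
proof (cases "pverts G = {}")
  case True
  then show ?thesis using G by (simp add: ndl_graph_def)
next
  case False
  then obtain u where u: "u \<in> pverts G" by blast
  have "real d = (\<Sum>v\<in>pverts G. adj G u v)"
    using adj_row_sum[OF G u] by simp
  also have "\<dots> \<le> (\<Sum>v\<in>pverts G. 1)"
    by (intro sum_mono) (simp add: adj_def)
  also have "\<dots> = real n" using G by (simp add: ndl_graph_def)
  finally show ?thesis by (auto simp: divide_le_eq_1)
qed

text \<open>The hypothesis \<open>half\<close> turns the degree bound relative to \<open>U\<close>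
  into one relative to \<open>W\<close>. The absolute value is taken because \<open>l\<close> can be
  negative when there is no nonprincipal eigenvalue.\<close>

lemma H2_typical_part:
  fixes n d :: nat and l :: real
  assumes G: "ndl_graph G n d l" and U: "U \<subseteq> pverts G"
    and W: "W = typical_part G (d / n) U" and half: "card U \<le> 2 * card W"
  shows "\<bar>real (H2 G W) - (d / n) ^ 6 * card W ^ 5\<bar>
    \<le> 291 * (l\<^sup>2 * (d / n)\<^sup>2 * card W ^ 3) + 6 * \<bar>l\<bar> * (d / n) ^ 5 * card W ^ 4"
proof -
  have fin: "finite U" using U ndl_graph_finite[OF G] finite_subset by blast
  have WU: "W \<subseteq> U" by (auto simp: W typical_part_def)
  have "(\<Sum>v\<in>W. adj G u v) \<le> 4 * (d / n) * card W" if "u \<in> W" for u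
  proof -
    have "(\<Sum>v\<in>W. adj G u v) \<le> (\<Sum>v\<in>U. adj G u v)"
      using fin WU by (intro sum_mono2) (auto simp: adj_def)
    also have "\<dots> \<le> 2 * (d / n) * card U"
      using that by (simp add: W typical_part_def)
    also have "\<dots> \<le> 2 * (d / n) * (2 * card W)"
      using half by (intro mult_left_mono) auto
    finally show ?thesis by simp
  qed
  moreover have "W \<subseteq> pverts G" using WU U by blast
  ultimately show ?thesis
    using cubed_codegree_sum[of "d / n" "\<bar>l\<bar>" W "adj G"]
      ndl_graph_degree_le[OF G] adj_sym[OF G] ndl_graph_operator_bound_subset[OF G]
      H2_eq_sum_codegree_cubed[OF G]
    by (simp add: adj_def)
qed

section \<open>Passage to the asymptotic form\<close>

text \<open>Turns a sum of two errors into a relative error plus an absolute one. If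
  \<open>\<eta> * M\<close> covers \<open>x\<close>, all of \<open>x\<close> becomes relative error;
  otherwise \<open>\<epsilon> = \<eta>\<close> up to sign, and at most \<open>A\<close>
  remains.\<close>

lemma split_absolute_bound:
  fixes x A M \<eta> :: real
  assumes "\<bar>x\<bar> \<le> A + \<eta> * M" "0 \<le> A" "0 \<le> M" "0 \<le> \<eta>"
  obtains \<epsilon> where "\<bar>\<epsilon>\<bar> \<le> \<eta>" "\<bar>x - \<epsilon> * M\<bar> \<le> A"
proof (cases "\<bar>x\<bar> \<le> \<eta> * M")
  case True
  show ?thesis
  proof (cases "M = 0")
    case False
    then have "\<bar>x / M\<bar> \<le> \<eta>" using True assms by (simp add: divide_le_eq)
    then show ?thesis using that[of "x / M"] False assms by simp
  qed (use that[of 0] True assms in simp)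
next
  case False
  show ?thesis
    using that[of "sgn x * \<eta>"] False assms
    by (cases x "0::real" rule: linorder_cases) (auto simp: abs_mult)
qed

text \<open>Divided by the main term, the error linear in \<open>l\<close> is
  \<open>6 * \<bar>l\<bar> * (n / d) / card W\<close>; replacing \<open>card W\<close> by
  \<open>card U / 2\<close> gives the 12.\<close>

lemma H2_typical_part_relative:
  fixes n d :: nat and l :: real
  assumes G: "ndl_graph G n d l" and U: "U \<subseteq> pverts G"
    and W: "W = typical_part G (d / n) U" and half: "card U \<le> 2 * card W"
  obtains \<epsilon> where "\<bar>\<epsilon>\<bar> \<le> 12 * \<bar>l * n / d / card U\<bar>"
    "\<bar>real (H2 G W) - (1 + \<epsilon>) * (real (card W) ^ 5 * real d ^ 6 / real n ^ 6)\<bar>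
      \<le> 291 * (l ^ 2 * (real (card W) ^ 3 * real d ^ 2 / real n ^ 2))"
proof -
  define m where "m = real (card W)"
  define M where "M = m ^ 5 * real d ^ 6 / real n ^ 6"
  define A where "A = 291 * (l ^ 2 * (m ^ 3 * real d ^ 2 / real n ^ 2))"
  define \<eta> where "\<eta> = 12 * \<bar>l * n / d / card U\<bar>"
  have M_alt: "M = (d / n) ^ 6 * m ^ 5"
    by (simp add: M_def power_divide)
  have "6 * \<bar>l\<bar> * (d / n) ^ 5 * m ^ 4 \<le> \<eta> * M"
  \<comment> \<open>In the degenerate cases both sides are 0, with division by zero yielding
    0.\<close>
  proof (cases "d = 0 \<or> n = 0 \<or> m = 0")
    case True
    then show ?thesis by (auto simp: M_alt)
  next
    case False
    have "finite U" using U ndl_graph_finite[OF G] finite_subset by blast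
    then have "card W \<le> card U"
      by (intro card_mono) (auto simp: W typical_part_def)
    then have U_pos: "card U > 0" using False by (simp add: m_def)
    have "6 * \<bar>l\<bar> * (d / n) ^ 5 * m ^ 4 = 6 * \<bar>l\<bar> * (n / d) / m * M"
      using False by (simp add: M_alt field_simps eval_nat_numeral)
    also have "\<dots> \<le> \<eta> * M"
    proof (rule mult_right_mono)
      have "6 * \<bar>l\<bar> * (n / d) / m \<le> 6 * \<bar>l\<bar> * (n / d) / (card U / 2)"
        using half U_pos False by (intro divide_left_mono) (auto simp: m_def)
      then show "6 * \<bar>l\<bar> * (n / d) / m \<le> \<eta>"
        by (simp add: \<eta>_def abs_mult)
    qed (simp add: M_def m_def)
    finally show ?thesis .
  qed
  moreover have "291 * (l\<^sup>2 * (d / n)\<^sup>2 * m ^ 3) = A"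
    by (simp add: A_def power_divide)
  ultimately have "\<bar>real (H2 G W) - M\<bar> \<le> A + \<eta> * M"
    using H2_typical_part[OF assms] by (simp add: M_alt m_def)
  moreover have "0 \<le> A" "0 \<le> M" "0 \<le> \<eta>"
    by (auto simp: A_def M_def \<eta>_def m_def)
  ultimately obtain \<epsilon> where "\<bar>\<epsilon>\<bar> \<le> \<eta>" "\<bar>real (H2 G W) - M - \<epsilon> * M\<bar> \<le> A"
    by (rule split_absolute_bound)
  moreover have "real (H2 G W) - M - \<epsilon> * M = real (H2 G W) - (1 + \<epsilon>) * M"
    by (simp add: algebra_simps)
  ultimately show ?thesis
    using that[of \<epsilon>] by (simp add: \<eta>_def M_def A_def m_def)
qed

lemma atypical_fraction_le:
  fixes n d :: nat and l :: real
  assumes G: "ndl_graph G n d l" and U: "U \<subseteq> pverts G"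
  shows "card (U - typical_part G (d / n) U) / card U \<le> (l * n / d / card U)\<^sup>2"
\<comment> \<open>For \<open>d = 0\<close> the right-hand side is 0 by the convention on division,
  so there must be no atypical vertex at all. For \<open>card U = 0\<close> both quotients are
  0.\<close>
proof (cases "d = 0 \<or> card U = 0")
  case True
  have "(\<Sum>v\<in>U. adj G u v) = 0" if "d = 0" "u \<in> U" for u
  proof -
    have "(\<Sum>v\<in>U. adj G u v) \<le> (\<Sum>v\<in>pverts G. adj G u v)"
      using U ndl_graph_finite[OF G] by (intro sum_mono2) (auto simp: adj_def)
    also have "\<dots> = 0" using adj_row_sum[OF G, of u] that U by auto
    finally show ?thesis
      by (simp add: adj_def order.antisym sum_nonneg)
  qed
  then have "card (U - typical_part G (d / n) U) = 0" if "d = 0"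
    using that by (auto simp: typical_part_def card_eq_0_iff)
  then show ?thesis using True by fastforce
next
  case False
  have "n > 0"
    using False card_mono[OF ndl_graph_finite[OF G] U] G by (simp add: ndl_graph_def)
  then show ?thesis
    using card_atypical_part[OF assms] False by (simp add: field_simps power2_eq_square)
qed

text \<open>The constant is chosen before the sequences, hence absolute. The estimate holds
  eventually, namely once \<open>U'\<close> contains at least half of \<open>U\<close>.\<close>

theorem theorem3p2:
  shows "\<exists>C>0. \<forall>(G :: nat \<Rightarrow> 'a pair_pre_digraph) (n :: nat \<Rightarrow> nat) (d :: nat \<Rightarrow> nat)
            (l :: nat \<Rightarrow> real) (U :: nat \<Rightarrow> 'a set).
    (\<forall>k. ndl_graph (G k) (n k) (d k) (l k)) \<longrightarrow>
    filterlim n at_top sequentially \<longrightarrow>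
    (\<forall>k. U k \<subseteq> pverts (G k)) \<longrightarrow>
    (\<lambda>k. l k * real (n k) / real (d k)) \<in> o(\<lambda>k. real (card (U k))) \<longrightarrow>
    (\<exists>(U' :: nat \<Rightarrow> 'a set) (\<delta> :: nat \<Rightarrow> real) (\<epsilon> :: nat \<Rightarrow> real).
       (\<forall>k. U' k \<subseteq> U k) \<and>
       \<delta> \<longlonglongrightarrow> 0 \<and> (\<forall>k. real (card (U' k)) = (1 - \<delta> k) * real (card (U k))) \<and>
       \<epsilon> \<longlonglongrightarrow> 0 \<and>
       (\<forall>\<^sub>F k in sequentially.
          \<bar>real (H2 (G k) (U' k)) -
             (1 + \<epsilon> k) * (real (card (U' k)) ^ 5 * real (d k) ^ 6 / real (n k) ^ 6)\<bar>
          \<le> C * (l k ^ 2 * (real (card (U' k)) ^ 3 * real (d k) ^ 2 / real (n k) ^ 2))))"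
proof (intro exI[of _ "291::real"] conjI allI impI)
  fix G :: "nat \<Rightarrow> 'a pair_pre_digraph" and n d :: "nat \<Rightarrow> nat" and l :: "nat \<Rightarrow> real"
    and U :: "nat \<Rightarrow> 'a set"
  assume "\<forall>k. ndl_graph (G k) (n k) (d k) (l k)" and "\<forall>k. U k \<subseteq> pverts (G k)"
    and small: "(\<lambda>k. l k * real (n k) / real (d k)) \<in> o(\<lambda>k. real (card (U k)))"
  then have G: "ndl_graph (G k) (n k) (d k) (l k)" and U: "U k \<subseteq> pverts (G k)" for k
    by auto
  define t where "t k = l k * n k / d k / card (U k)" for k
  define U' where "U' k = typical_part (G k) (d k / n k) (U k)" for k
  define \<delta> where "\<delta> k = card (U k - U' k) / card (U k)" for k
  have t: "t \<longlonglongrightarrow> 0"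
    using smalloD_tendsto[OF small] by (simp add: t_def[abs_def])
  have U'_sub: "U' k \<subseteq> U k" for k
    by (auto simp: U'_def typical_part_def)
  have \<delta>_bound: "\<bar>\<delta> k\<bar> \<le> (t k)\<^sup>2" for k
    using atypical_fraction_le[OF G U, of k] by (simp add: \<delta>_def U'_def t_def)
  have \<delta>: "\<delta> \<longlonglongrightarrow> 0"
    by (rule tendsto_0_le[of "\<lambda>k. (t k)\<^sup>2" _ _ 1])
       (use \<delta>_bound tendsto_power[OF t, of 2] in auto)
  have card_U': "real (card (U' k)) = (1 - \<delta> k) * real (card (U k))" for k
  proof -
    have fin: "finite (U k)" using U ndl_graph_finite[OF G] finite_subset by blast
    have card_sum: "card (U' k) + card (U k - U' k) = card (U k)"
      using fin U'_sub[of k] by (simp add: card_Diff_subset card_mono finite_subset)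
    show ?thesis
    proof (cases "card (U k) = 0")
      case False
      have "real (card (U' k)) = real (card (U k)) - real (card (U k - U' k))"
        using card_sum by linarith
      then show ?thesis using False by (simp add: \<delta>_def left_diff_distrib)
    qed (use card_sum in simp)
  qed
  \<comment> \<open>Stated for every \<open>k\<close>, with the default 0 where \<open>U'\<close> is
    too small, so that a whole sequence bounded by \<open>12 * \<bar>t k\<bar>\<close> can be
    chosen.\<close>
  have "\<exists>e. \<bar>e\<bar> \<le> 12 * \<bar>t k\<bar> \<and> (card (U k) \<le> 2 * card (U' k) \<longrightarrow>
      \<bar>real (H2 (G k) (U' k)) -
             (1 + e) * (real (card (U' k)) ^ 5 * real (d k) ^ 6 / real (n k) ^ 6)\<bar>
          \<le> 291 * (l k ^ 2 * (real (card (U' k)) ^ 3 * real (d k) ^ 2 / real (n k) ^ 2)))" for k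
  proof (cases "card (U k) \<le> 2 * card (U' k)")
    case True
    show ?thesis
      by (rule H2_typical_part_relative[OF G U U'_def True]) (auto simp: t_def)
  qed (auto intro: exI[of _ 0])
  then obtain \<epsilon> where \<epsilon>_bound: "\<And>k. \<bar>\<epsilon> k\<bar> \<le> 12 * \<bar>t k\<bar>"
    and \<epsilon>: "\<And>k. card (U k) \<le> 2 * card (U' k) \<Longrightarrow>
      \<bar>real (H2 (G k) (U' k)) -
             (1 + \<epsilon> k) * (real (card (U' k)) ^ 5 * real (d k) ^ 6 / real (n k) ^ 6)\<bar>
          \<le> 291 * (l k ^ 2 * (real (card (U' k)) ^ 3 * real (d k) ^ 2 / real (n k) ^ 2))"
    by metis
  have \<epsilon>_lim: "\<epsilon> \<longlonglongrightarrow> 0"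
    by (rule tendsto_0_le[OF t, of _ 12]) (use \<epsilon>_bound in \<open>auto simp: mult.commute\<close>)
  have "\<forall>\<^sub>F k in sequentially. \<delta> k < 1 / 2"
    using order_tendstoD(2)[OF \<delta>, of "1 / 2"] by simp
  then have "\<forall>\<^sub>F k in sequentially. card (U k) \<le> 2 * card (U' k)"
  proof eventually_elim
    case (elim k)
    then have "1 / 2 * real (card (U k)) \<le> (1 - \<delta> k) * real (card (U k))"
      by (intro mult_right_mono) auto
    then show ?case using card_U'[of k] by linarith
  qed
  then have "\<forall>\<^sub>F k in sequentially. \<bar>real (H2 (G k) (U' k)) -
             (1 + \<epsilon> k) * (real (card (U' k)) ^ 5 * real (d k) ^ 6 / real (n k) ^ 6)\<bar>
          \<le> 291 * (l k ^ 2 * (real (card (U' k)) ^ 3 * real (d k) ^ 2 / real (n k) ^ 2))"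
    by (rule eventually_mono) (rule \<epsilon>)
  then show "\<exists>(U' :: nat \<Rightarrow> 'a set) (\<delta> :: nat \<Rightarrow> real) (\<epsilon> :: nat \<Rightarrow> real).
       (\<forall>k. U' k \<subseteq> U k) \<and>
       \<delta> \<longlonglongrightarrow> 0 \<and> (\<forall>k. real (card (U' k)) = (1 - \<delta> k) * real (card (U k))) \<and>
       \<epsilon> \<longlonglongrightarrow> 0 \<and>
       (\<forall>\<^sub>F k in sequentially.
          \<bar>real (H2 (G k) (U' k)) -
             (1 + \<epsilon> k) * (real (card (U' k)) ^ 5 * real (d k) ^ 6 / real (n k) ^ 6)\<bar>
          \<le> 291 * (l k ^ 2 * (real (card (U' k)) ^ 3 * real (d k) ^ 2 / real (n k) ^ 2)))"
    using U'_sub \<delta> card_U' \<epsilon>_lim by blast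
qed simp

end
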